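(* Let $d\geq 1$ and $v\geq d+1$ be integers, and let $C(v,d)\subset\mathbb{R}^d$ be the cyclic polytope, i.e. the convex hull of any $v$ distinct points on the moment curve $\{(t,t^2,\ldots,t^d): t\in\mathbb{R}\}$. For $-1\leq k\leq d$ let $f_k$ denote the number of $k$-dimensional faces of $C(v,d)$, where $f_{-1}=1$ (counting the empty face) and $f_d=1$ (counting the polytope itself). Then the sequence $f_{-1},f_0,\ldots,f_{d-1},f_d$ is log-concave, that is, $$f_{i-1}\,f_{i+1}\leq f_i^2\qquad\text{for all integers } i \text{ with } -1<i<d.$$
   Context: The combinatorial type of $C(v,d)$, and hence the numbers $f_k$, depend only on $v$ and $d$ and not on the chosen points on the moment curve. The $f$-vector of a $d$-polytope records its numbers $f_k$ of $k$-dimensional faces, with $f_{-1}=1$ for the empty face. A sequence $f_{-1},f_0,\ldots,f_d$ is called log-concave if $f_{i-1}f_{i+1}\leq f_i^2$ for all $-1<i<d$. *)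

theory Defs
  imports "HOL-Analysis.Analysis"
begin

(* The coordinates of real ^ 'n are listed in the order of 'n: card {..i} is the
   1-based rank of the index i, so this is the point (t, t^2, ..., t^d), d = CARD('n). *)
definition moment_curve :: "real \<Rightarrow> real ^ 'n::{finite,linorder}" where
  "moment_curve t = (\<chi> i. t ^ card {..i})"

(* The cyclic polytope C(v,d) spanned by the points with parameters in T, card T = v. *)
definition cyclic_polytope :: "real set \<Rightarrow> (real ^ 'n::{finite,linorder}) set" where
  "cyclic_polytope T = convex hull (moment_curve ` T)"

(* face_of admits both the empty set, with aff_dim {} = -1, and the polytope itself,
   so both improper faces are counted. *)
definition num_faces :: "'a::euclidean_space set \<Rightarrow> int \<Rightarrow> nat" where
  "num_faces P k = card {F. F face_of P \<and> aff_dim F = k}"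

definition log_concave :: "(int \<Rightarrow> nat) \<Rightarrow> int \<Rightarrow> bool" where
  "log_concave f d \<longleftrightarrow> (\<forall>i. -1 < i \<and> i < d \<longrightarrow> f (i - 1) * f (i + 1) \<le> (f i)\<^sup>2)"

end

theory Submission
  imports Defs
begin

text \<open>
  Let \<open>P\<close> be the cyclic \<open>d\<close>-polytope on the parameter set \<open>T\<close>. The proof has a geometric part, a
  count, and an inequality on sequences.

  Restricted to the moment curve, affine functionals are exactly the polynomials of degree at most \<open>d\<close>. So a
  set \<open>S\<close> of at most \<open>d\<close> parameters spans a face if and only if some polynomial of degree at most \<open>d\<close>
  vanishes on \<open>S\<close> and is positive on the rest of \<open>T\<close>; the face is then a simplex, because points on the
  curve are in general position (\<open>num_faces_eq_card_face_parameters\<close>). Whether such a polynomial exists depends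
  only on the word that tells which elements of \<open>T\<close>, in increasing order, belong to \<open>S\<close>: dividing by linear
  factors from the left shows that the least possible degree is a simple recursive function of this word
  (\<open>ex_realises\<close>, \<open>word_degree_le_degree\<close>). This replaces Gale's evenness condition and applies to faces of
  every dimension.

  The recursion on words gives a recursion for the face polynomial, in which a polytope is reduced to the
  one with one vertex fewer and to the one with two vertices fewer in two dimensions less. By Pascal's rule the
  h-vector \<open>h i = (m + min i (d - i) choose min i (d - i))\<close>, where \<open>P\<close> has \<open>d + 1 + m\<close> vertices,
  satisfies the same recursion (\<open>word_gf_eq_h_poly\<close>). Hence the number of faces of codimension \<open>k + 1\<close> is the
  sum of \<open>h i * (d - i choose k)\<close> over \<open>i \<le> d\<close>, and this is the \<open>(k + 1)\<close>-fold iterated partial sum of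
  the h-vector (\<open>num_faces_cyclic_polytope\<close>).

  The h-vector is log-concave without internal zeros, as two diagonals of Pascal's triangle joined at their peak
  (\<open>log_concave_cyclic_h\<close>). Finally, for every such sequence the iterated sums, evaluated at a fixed argument,
  are log-concave in the number of summations: the quotient of a partial sum by the next term of the sequence
  grows, and summation preserves this (\<open>iterated_sum_log_concave\<close>). This settles all inequalities except the one
  that involves the polytope itself as a face, which follows from there being more than \<open>d\<close> facets.
\<close>

section \<open>Log-concave sequences and their iterated sums\<close>

text \<open>
  Unlike the inequalities \<open>a (n + 1) * a (n - 1) \<le> (a n)\<^sup>2\<close> alone, this cross-multiplied form (the ratio of
  consecutive terms decreases) also forbids internal zeros. It is the form that passes to partial sums.
\<close>

definition log_concave_seq :: "(nat \<Rightarrow> nat) \<Rightarrow> bool" where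
  "log_concave_seq a \<longleftrightarrow> (\<forall>n j. j \<le> n \<longrightarrow> a (Suc n) * a j \<le> a n * a (Suc j))"

text \<open>
  The sums run over \<open>j < n\<close> and not \<open>j \<le> n\<close>: with this shift, consecutive iterates at one and the same
  argument are exactly the consecutive face numbers of a polytope.
\<close>

fun iterated_sum :: "nat \<Rightarrow> (nat \<Rightarrow> nat) \<Rightarrow> nat \<Rightarrow> nat" where
  "iterated_sum 0 a n = a n"
| "iterated_sum (Suc k) a n = (\<Sum>j<n. iterated_sum k a j)"

text \<open>
  Each application of the defining inequality moves the two indices \<open>j + t\<close> and \<open>i\<close> one step towards each
  other; the process ends at the latest when the lower index reaches \<open>j\<close>.
\<close>

lemma log_concave_seq_shift:
  assumes "log_concave_seq a" and "i \<le> j"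
  shows "a (j + t) * a i \<le> a j * a (i + t)"
  using assms(2)
proof (induction t arbitrary: i)
  case 0
  show ?case by (simp add: mult.commute)
next
  case (Suc t)
  show ?case
  proof (cases "i = j")
    case True
    then show ?thesis by (simp add: mult.commute)
  next
    case False
    have "a (j + Suc t) * a i \<le> a (j + t) * a (Suc i)"
      using assms(1) Suc.prems unfolding log_concave_seq_def by simp
    also have "\<dots> \<le> a j * a (Suc i + t)"
      using Suc.IH[of "Suc i"] Suc.prems False by simp
    finally show ?thesis by simp
  qed
qed

text \<open>
  The sum of the first \<open>n\<close> terms divided by the next term grows with \<open>n\<close>. This one inequality yields both
  that partial sums are log-concave and that consecutive iterated sums are.
\<close>

lemma log_concave_seq_ratio:
  assumes "log_concave_seq a" and "j \<le> n"
  shows "a n * (\<Sum>i<j. a i) \<le> a j * (\<Sum>i<n. a i)"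
proof -
  define t where "t = n - j"
  have n: "n = j + t" using assms(2) by (simp add: t_def)
  have "a n * (\<Sum>i<j. a i) = (\<Sum>i<j. a (j + t) * a i)"
    by (simp add: n sum_distrib_left)
  also have "\<dots> \<le> (\<Sum>i<j. a j * a (i + t))"
    by (intro sum_mono log_concave_seq_shift assms(1)) auto
  also have "\<dots> = a j * (\<Sum>i\<in>(\<lambda>i. i + t) ` {..<j}. a i)"
    by (simp add: sum_distrib_left sum.reindex)
  also have "\<dots> \<le> a j * (\<Sum>i<n. a i)"
    by (intro mult_left_mono sum_mono2) (auto simp: n)
  finally show ?thesis .
qed

lemma log_concave_seq_sum:
  assumes "log_concave_seq a"
  shows "log_concave_seq (\<lambda>n. \<Sum>i<n. a i)"
  unfolding log_concave_seq_def
  using log_concave_seq_ratio[OF assms] by (simp add: algebra_simps)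

lemma log_concave_seq_iterated_sum:
  "log_concave_seq a \<Longrightarrow> log_concave_seq (iterated_sum k a)"
proof (induction k)
  case 0
  have "iterated_sum 0 a = a" by auto
  then show ?case using 0 by simp
next
  case (Suc k)
  have "iterated_sum (Suc k) a = (\<lambda>n. \<Sum>i<n. iterated_sum k a i)" by auto
  then show ?case using Suc log_concave_seq_sum by simp
qed

text \<open>
  Log-concavity in the number of summations, not in the argument. With \<open>s\<close> for the lowest of the three
  iterates, the product on the left is the sum of \<open>s n * (s 0 + \<dots> + s (j - 1))\<close> over \<open>j < n\<close>, and the
  ratio inequality bounds this term by term by the square of \<open>s 0 + \<dots> + s (n - 1)\<close>.
\<close>

lemma iterated_sum_log_concave:
  assumes "log_concave_seq a"
  shows "iterated_sum k a n * iterated_sum (Suc (Suc k)) a n \<le> (iterated_sum (Suc k) a n)\<^sup>2"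
proof -
  let ?s = "iterated_sum k a"
  have "?s n * iterated_sum (Suc (Suc k)) a n = (\<Sum>j<n. ?s n * (\<Sum>i<j. ?s i))"
    by (simp add: sum_distrib_left)
  also have "\<dots> \<le> (\<Sum>j<n. ?s j * (\<Sum>i<n. ?s i))"
    by (intro sum_mono log_concave_seq_ratio log_concave_seq_iterated_sum assms) auto
  also have "\<dots> = (iterated_sum (Suc k) a n)\<^sup>2"
    by (simp add: power2_eq_square sum_distrib_right)
  finally show ?thesis .
qed

text \<open>
  The right-hand side is the usual passage from an h-vector to the number of faces of codimension
  \<open>k + 1\<close>; Pascal's rule turns it into iterated summation.
\<close>

lemma iterated_sum_eq_binomial:
  "iterated_sum (Suc k) a (Suc n) = (\<Sum>i\<le>n. a i * ((n - i) choose k))"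
proof (induction k arbitrary: n)
  case 0
  show ?case by (simp add: lessThan_Suc_atMost)
next
  case (Suc k)
  show ?case
  proof (induction n)
    case 0
    show ?case by simp
  next
    case (Suc n)
    have "iterated_sum (Suc (Suc k)) a (Suc (Suc n))
        = iterated_sum (Suc (Suc k)) a (Suc n) + iterated_sum (Suc k) a (Suc n)"
      by simp
    also have "\<dots> = (\<Sum>i\<le>n. a i * ((n - i) choose Suc k)) + (\<Sum>i\<le>n. a i * ((n - i) choose k))"
      using Suc.IH \<open>\<And>n. iterated_sum (Suc k) a (Suc n) = _ n\<close> by simp
    also have "\<dots> = (\<Sum>i\<le>n. a i * ((Suc n - i) choose Suc k))"
      unfolding sum.distrib[symmetric]
      by (intro sum.cong) (auto simp: Suc_diff_le algebra_simps)
    finally show ?case by simp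
  qed
qed

section \<open>The h-vector of a cyclic polytope\<close>

text \<open>
  The h-vector of the boundary of the cyclic \<open>d\<close>-polytope with \<open>d + 1 + m\<close> vertices, extended by zero.
\<close>

definition cyclic_h :: "nat \<Rightarrow> nat \<Rightarrow> nat \<Rightarrow> nat" where
  "cyclic_h m d i = (if i \<le> d then (m + min i (d - i)) choose min i (d - i) else 0)"

text \<open>
  The ratio of consecutive terms is \<open>(m + j + 1) / (j + 1)\<close>, which decreases in \<open>j\<close>.
\<close>

lemma binomial_diagonal_log_concave:
  "((m + j) choose j) * ((m + Suc (Suc j)) choose Suc (Suc j)) \<le> ((m + Suc j) choose Suc j)\<^sup>2"
proof -
  define c where "c = (\<lambda>j. (m + j) choose j)"
  have step: "Suc j * c (Suc j) = (m + Suc j) * c j" for j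
    using Suc_times_binomial_eq[of "m + j" j] by (simp add: c_def)
  have "(c j * c (Suc (Suc j))) * (Suc (Suc j) * (m + Suc j))
      = ((m + Suc j) * c j) * (Suc (Suc j) * c (Suc (Suc j)))"
    by (simp only: mult_ac)
  also have "\<dots> = (Suc j * c (Suc j)) * ((m + Suc (Suc j)) * c (Suc j))"
    by (simp only: step)
  also have "\<dots> = (c (Suc j))\<^sup>2 * (Suc j * (m + Suc (Suc j)))"
    by (simp only: power2_eq_square mult_ac)
  also have "\<dots> \<le> (c (Suc j))\<^sup>2 * (Suc (Suc j) * (m + Suc j))"
    by (intro mult_left_mono) (auto simp: algebra_simps)
  finally show ?thesis
    unfolding c_def by (simp only: mult_le_cancel2) simp
qed

text \<open>
  On each half of its range the sequence is a log-concave diagonal of Pascal's triangle, or its reversal. At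
  the middle both neighbours of the central entry are at most as large as it, because the diagonal increases.
\<close>

lemma cyclic_h_log_concave: "cyclic_h m d (Suc (Suc i)) * cyclic_h m d i \<le> (cyclic_h m d (Suc i))\<^sup>2"
proof (cases "Suc (Suc i) \<le> d")
  case False
  then show ?thesis by (simp add: cyclic_h_def)
next
  case True
  define c where "c = (\<lambda>j. (m + j) choose j)"
  have mono: "c a \<le> c b" if "a \<le> b" for a b
    using lift_Suc_mono_le[of c a b] that by (simp add: c_def)
  \<comment> \<open>The three indices \<open>i\<close>, \<open>i + 1\<close>, \<open>i + 2\<close> leave \<open>e\<close> entries above them: compare \<open>i\<close> with \<open>e\<close>.\<close>
  define e where "e = d - Suc (Suc i)"
  have d: "d = Suc (Suc (i + e))" using True by (simp add: e_def)
  have h: "cyclic_h m d i = c (min i (Suc (Suc e)))"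
    "cyclic_h m d (Suc i) = c (min (Suc i) (Suc e))"
    "cyclic_h m d (Suc (Suc i)) = c (min (Suc (Suc i)) e)"
    by (simp_all add: cyclic_h_def c_def d)
  consider "Suc (Suc i) \<le> e" | "Suc (Suc e) \<le> i" | "e \<le> Suc i" "i \<le> Suc e" by linarith
  then show ?thesis
  proof cases
    case 1
    then show ?thesis
      using binomial_diagonal_log_concave[of m i] by (simp add: h min_def c_def mult.commute)
  next
    case 2
    then show ?thesis
      using binomial_diagonal_log_concave[of m e] by (simp add: h min_def c_def)
  next
    case 3
    then show ?thesis unfolding h power2_eq_square by (intro mult_mono mono) auto
  qed
qed

lemma cyclic_h_pos: "i \<le> d \<Longrightarrow> cyclic_h m d i > 0"
  by (simp add: cyclic_h_def)

lemma log_concave_cyclic_h: "log_concave_seq (cyclic_h m d)"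
proof -
  let ?h = "cyclic_h m d"
  have "?h (Suc (j + t)) * ?h j \<le> ?h (j + t) * ?h (Suc j)" for j t
  proof (induction t)
    case 0
    show ?case by (simp add: mult.commute)
  next
    case (Suc t)
    show ?case
    proof (cases "Suc (j + t) \<le> d")
      case False
      then show ?thesis by (simp add: cyclic_h_def)
    next
      case True
      let ?n = "j + t"
      have "(?h (Suc (Suc ?n)) * ?h j) * (?h ?n * ?h (Suc ?n))
          = (?h (Suc (Suc ?n)) * ?h ?n) * (?h (Suc ?n) * ?h j)"
        by (simp only: mult_ac)
      also have "\<dots> \<le> (?h (Suc ?n))\<^sup>2 * (?h ?n * ?h (Suc j))"
        by (intro mult_mono cyclic_h_log_concave Suc.IH) auto
      also have "\<dots> = (?h (Suc ?n) * ?h (Suc j)) * (?h ?n * ?h (Suc ?n))"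
        by (simp only: power2_eq_square mult_ac)
      finally have "?h (Suc (Suc ?n)) * ?h j \<le> ?h (Suc ?n) * ?h (Suc j)"
        using cyclic_h_pos[of ?n d m] cyclic_h_pos[of "Suc ?n" d m] True
        by (simp only: mult_le_cancel2) simp
      then show ?thesis by simp
    qed
  qed
  then show ?thesis
    unfolding log_concave_seq_def by (metis le_Suc_ex)
qed

text \<open>
  Pascal's rule on each half. The last summand is an entry of the h-vector in dimension \<open>d - 2\<close>, with two
  vertices fewer than on the left-hand side; the same recursion governs the words counted below.
\<close>

lemma cyclic_h_rec:
  "cyclic_h (Suc m) d i = cyclic_h m d i +
     (if 1 \<le> i \<and> i < d then cyclic_h (Suc m) (d - 2) (i - 1) else 0)"
proof (cases "1 \<le> i \<and> i < d")
  case False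
  then have "i = 0 \<or> i = d \<or> i > d" by linarith
  then show ?thesis by (auto simp: cyclic_h_def)
next
  case True
  define j where "j = min i (d - i) - 1"
  have 1: "min i (d - i) = Suc j" "min (i - 1) (d - 2 - (i - 1)) = j"
    using True by (auto simp: j_def)
  have "cyclic_h (Suc m) d i = (Suc m + Suc j) choose Suc j"
    "cyclic_h m d i = (m + Suc j) choose Suc j"
    "cyclic_h (Suc m) (d - 2) (i - 1) = (Suc m + j) choose j"
    using True unfolding cyclic_h_def 1 by auto
  then show ?thesis using True by simp
qed

section \<open>Polynomials with prescribed zeros and signs\<close>

text \<open>
  A word records, for the points of a finite set of reals in increasing order, at which of them a polynomial
  has to vanish (\<open>True\<close>); at the others it has to be positive. \<open>word_degree\<close> is the least degree of a nonzero
  polynomial that does so, and \<open>inner_degree\<close> is the least degree if the polynomial has to be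
  positive at some point further left as well. In terms of Gale's evenness condition, \<open>word_degree\<close> is the
  number of zeros plus the number of runs of zeros that have odd length and touch neither end of the word.
  Between two points of positivity zeros come in pairs, which is why the last equation for \<open>inner_degree\<close>
  does not depend on the letter \<open>w\<close>: the partner of a zero is the next point if it has to be a zero too, and
  otherwise an additional root that restores the sign.
\<close>

fun inner_degree :: "bool list \<Rightarrow> nat" where
  "inner_degree [] = 0"
| "inner_degree (False # ws) = inner_degree ws"
| "inner_degree [True] = 1"
| "inner_degree (True # w # ws) = inner_degree ws + 2"

fun word_degree :: "bool list \<Rightarrow> nat" where
  "word_degree [] = 0"
| "word_degree (False # ws) = inner_degree ws"
| "word_degree (True # ws) = word_degree ws + 1"

definition realises :: "real poly \<Rightarrow> real list \<Rightarrow> bool list \<Rightarrow> bool" where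
  "realises p = list_all2 (\<lambda>t w. if w then poly p t = 0 else 0 < poly p t)"

lemma realises_simps [simp]:
  "realises p [] []"
  "realises p (t # ts) (w # ws) \<longleftrightarrow>
     (if w then poly p t = 0 else 0 < poly p t) \<and> realises p ts ws"
  by (simp_all add: realises_def)

lemma realises_length: "realises p ts ws \<Longrightarrow> length ts = length ws"
  by (simp add: realises_def list_all2_lengthD)

lemma realises_mult_pos:
  assumes "\<And>t. t \<in> set ts \<Longrightarrow> 0 < poly q t"
  shows "realises (q * p) ts ws \<longleftrightarrow> realises p ts ws"
  unfolding realises_def
proof (rule list.rel_cong)
  fix t w assume "t \<in> set ts"
  then have "0 < poly q t" by (rule assms)
  then show "(if w then poly (q * p) t = 0 else 0 < poly (q * p) t)
      = (if w then poly p t = 0 else 0 < poly p t)"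
    by (auto simp: zero_less_mult_iff)
qed auto

lemma degree_mult_le_add:
  "degree p \<le> m \<Longrightarrow> degree q \<le> n \<Longrightarrow> degree (p * q) \<le> m + n"
  by (rule order.trans[OF degree_mult_le]) simp

text \<open>
  The quadratic factor for a leading \<open>True\<close> is the product of the linear factors at the first two points
  if both have to be zeros, and the square of the first linear factor otherwise; either is positive at all other
  points.
\<close>

lemma ex_realises_inner:
  assumes "sorted_wrt (<) ts" and "length ts = length ws"
  shows "\<exists>p. degree p \<le> inner_degree ws \<and> realises p ts ws \<and>
           (\<forall>x. (\<forall>t\<in>set ts. x < t) \<longrightarrow> 0 < poly p x)"
  using assms
proof (induction ws arbitrary: ts rule: inner_degree.induct)
  case 1
  then show ?case by (intro exI[of _ 1]) auto
next
  case (2 ws)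
  then obtain t us where ts: "ts = t # us" by (cases ts) auto
  obtain p where p: "degree p \<le> inner_degree ws" "realises p us ws"
    "\<And>x. (\<forall>t\<in>set us. x < t) \<Longrightarrow> 0 < poly p x"
    using 2 by (force simp: ts)
  show ?case using 2 p by (intro exI[of _ p]) (auto simp: ts)
next
  case 3
  then obtain t where ts: "ts = [t]" by (cases ts) auto
  show ?case by (intro exI[of _ "[:t, -1:]"]) (auto simp: ts)
next
  case (4 w ws)
  then obtain s t us where ts: "ts = s # t # us" by (cases ts; cases "tl ts") auto
  obtain p where p: "degree p \<le> inner_degree ws" "realises p us ws"
    "\<And>x. (\<forall>t\<in>set us. x < t) \<Longrightarrow> 0 < poly p x"
    using 4 by (force simp: ts)
  define r where "r = (if w then t else s)"
  define q where "q = [:-s, 1:] * [:-r, 1:]"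
  have q: "poly q x = (x - s) * (x - r)" for x
    by (simp add: q_def algebra_simps)
  have "degree q = 2" by (simp add: q_def degree_mult_eq)
  then have "degree (q * p) \<le> inner_degree (True # w # ws)"
    using degree_mult_le_add[of q 2 p "inner_degree ws"] p(1) by simp
  moreover have "realises (q * p) us ws"
    using 4 p(2) by (subst realises_mult_pos) (auto simp: q r_def ts intro!: mult_pos_pos)
  moreover have "0 < poly p t" using 4 by (intro p(3)) (auto simp: ts)
  ultimately show ?case
    using 4 p(3) by (intro exI[of _ "q * p"])
      (auto simp: q r_def ts zero_less_mult_iff)
qed

text \<open>
  Nothing is required to the left of the first point, so a zero in the initial run costs one linear factor
  and no sign has to be restored.
\<close>

lemma ex_realises:
  assumes "sorted_wrt (<) ts" and "length ts = length ws"
  shows "\<exists>p. degree p \<le> word_degree ws \<and> realises p ts ws"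
  using assms
proof (induction ws arbitrary: ts rule: word_degree.induct)
  case 1
  then show ?case by (intro exI[of _ 1]) auto
next
  case (2 ws)
  then obtain t us where ts: "ts = t # us" by (cases ts) auto
  show ?case using ex_realises_inner[of us ws] 2 by (fastforce simp: ts)
next
  case (3 ws)
  then obtain t us where ts: "ts = t # us" by (cases ts) auto
  obtain p where p: "degree p \<le> word_degree ws" "realises p us ws"
    using 3 by (force simp: ts)
  have "degree ([:-t, 1:] * p) \<le> 1 + word_degree ws"
    using p(1) by (intro degree_mult_le_add) auto
  moreover have "realises ([:-t, 1:] * p) us ws"
    using 3 p(2) by (subst realises_mult_pos) (auto simp: ts)
  ultimately show ?case by (intro exI[of _ "[:-t, 1:] * p"]) (auto simp: ts)
qed

text \<open>
  Dividing out the first zero \<open>s\<close> reverses the sign at \<open>a\<close>, whereas the sign at all later points is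
  kept. So the quotient has a second root, given by the next point or by the intermediate value theorem, and the
  induction goes on after dividing by it as well.
\<close>

lemma inner_degree_le_degree:
  assumes "sorted_wrt (<) (a # ts)" and "realises p ts ws" and "0 < poly p a"
  shows "inner_degree ws \<le> degree p"
  using assms
proof (induction ws arbitrary: ts a p rule: inner_degree.induct)
  case 1
  then show ?case by simp
next
  case (2 ws)
  then obtain t us where ts: "ts = t # us"
    by (cases ts) (auto dest: realises_length)
  show ?case using 2(1)[of t us p] 2(2-) by (auto simp: ts)
next
  case 3
  then obtain t where ts: "ts = [t]"
    by (cases ts) (auto dest: realises_length)
  have "degree p \<noteq> 0"
  proof
    assume "degree p = 0"
    then obtain c where "p = [:c:]" by (rule degree_eq_zeroE)
    then show False using 3 by (auto simp: ts)
  qed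
  then show ?case by simp
next
  case (4 w ws)
  from 4(3) obtain s t us where ts: "ts = s # t # us"
    by (cases ts; cases "tl ts") (auto dest: realises_length)
  have *: "sorted_wrt (<) us" "a < s" "s < t" "a < t" "\<And>x. x \<in> set us \<Longrightarrow> s < x \<and> t < x \<and> a < x"
    using 4(2) by (auto simp: ts)
  have "poly p s = 0" using 4(3) by (simp add: ts)
  then obtain p1 where p1: "p = [:-s, 1:] * p1" by (auto simp: poly_eq_0_iff_dvd elim: dvdE)
  have p1a: "poly p1 a < 0"
  proof -
    have "0 < (a - s) * poly p1 a" using 4(4) by (simp add: p1 algebra_simps)
    then show ?thesis using *(2) by (simp add: zero_less_mult_iff)
  qed
  have us: "realises p us ws" using 4(3) by (simp add: ts)
  have "p1 \<noteq> 0" using p1a by auto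
  \<comment> \<open>\<open>r\<close> is the second root and \<open>b\<close> the point of positivity that replaces \<open>a\<close> in the induction.\<close>
  obtain r b where r: "a < r" "r \<le> t" "poly p1 r = 0"
    and b: "\<And>p2. p1 = [:-r, 1:] * p2 \<Longrightarrow> 0 < poly p2 b" "\<And>x. x \<in> set us \<Longrightarrow> b < x"
  proof (cases w)
    case True
    have "poly p1 t = 0" using 4(3) *(3) True by (auto simp: ts p1)
    moreover have "0 < poly p2 a" if "p1 = [:-t, 1:] * p2" for p2
    proof -
      have "(a - t) * poly p2 a < 0" using p1a by (simp add: that algebra_simps)
      then show ?thesis using *(4) by (simp add: mult_less_0_iff)
    qed
    ultimately show ?thesis using *(4,5) that[of t a] by auto
  next
    case False
    have t: "0 < poly p1 t" 
    proof -
      have "0 < (t - s) * poly p1 t" using 4(3) False by (simp add: ts p1 algebra_simps)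
      then show ?thesis using *(3) by (simp add: zero_less_mult_iff)
    qed
    obtain r where r: "a < r" "r < t" "poly p1 r = 0"
      using poly_IVT_pos[OF *(4) p1a t] by auto
    have "0 < poly p2 t" if "p1 = [:-r, 1:] * p2" for p2
    proof -
      have "0 < (t - r) * poly p2 t" using t by (simp add: that algebra_simps)
      then show ?thesis using r by (simp add: zero_less_mult_iff)
    qed
    then show ?thesis using *(5) r that[of r t] by auto
  qed
  obtain p2 where p2: "p1 = [:-r, 1:] * p2"
    using r(3) by (auto simp: poly_eq_0_iff_dvd elim: dvdE)
  have p: "p = ([:-s, 1:] * [:-r, 1:]) * p2" by (simp only: p1 p2 mult.assoc)
  have "0 < poly ([:-s, 1:] * [:-r, 1:]) x" if "x \<in> set us" for x
  proof -
    have "0 < (x - s) * (x - r)" using *(5)[OF that] r(2) by (intro mult_pos_pos) auto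
    then show ?thesis by (simp add: algebra_simps)
  qed
  then have "realises p2 us ws"
    using us realises_mult_pos unfolding p by blast
  then have "inner_degree ws \<le> degree p2"
    using 4(1)[of b us p2] b(1)[OF p2] b(2) *(1) by simp
  moreover have "p2 \<noteq> 0" using \<open>p1 \<noteq> 0\<close> p2 by auto
  moreover have "degree ([:-s, 1:] * [:-r, 1:]) = 2" by (simp add: degree_mult_eq)
  ultimately show ?case unfolding p by (subst degree_mult_eq) auto
qed

lemma word_degree_le_degree:
  assumes "sorted_wrt (<) ts" and "realises p ts ws" and "p \<noteq> 0"
  shows "word_degree ws \<le> degree p"
  using assms
proof (induction ws arbitrary: ts p rule: word_degree.induct)
  case 1
  then show ?case by simp
next
  case (2 ws)
  then obtain t us where ts: "ts = t # us"
    by (cases ts) (auto dest: realises_length)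
  show ?case using inner_degree_le_degree[of t us p ws] 2 by (auto simp: ts)
next
  case (3 ws)
  then obtain t us where ts: "ts = t # us"
    by (cases ts) (auto dest: realises_length)
  obtain q where q: "p = [:-t, 1:] * q"
    using 3 by (auto simp: ts poly_eq_0_iff_dvd elim: dvdE)
  have "q \<noteq> 0" using 3 q by auto
  moreover have "realises q us ws"
    using 3 unfolding q by (auto simp: ts realises_mult_pos simp del: mult_pCons_left)
  ultimately show ?case
    using 3 by (auto simp: ts q degree_mult_eq simp del: mult_pCons_left)
qed

section \<open>Counting words by degree\<close>

definition X :: "int poly" where
  "X = monom 1 1"

lemma X_power: "X ^ n = monom 1 n"
  by (simp add: X_def monom_power)

lemma one_plus_X: "1 + X = [:1, 1:]"
  by (simp add: X_def monom_altdef one_pCons)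

text \<open>
  The variable marks the number of zeros that the word prescribes. The bound \<open>e\<close> is an integer, so that
  lowering it below zero leaves no words and the recursions need no case distinction on small bounds.
\<close>

definition word_gf :: "(bool list \<Rightarrow> nat) \<Rightarrow> nat \<Rightarrow> int \<Rightarrow> int poly" where
  "word_gf f n e = (\<Sum>ws | length ws = n. if int (f ws) \<le> e then X ^ count_list ws True else 0)"

lemma finite_words: "finite {ws :: bool list. length ws = n \<and> P ws}"
  by (rule finite_subset[OF _ finite_lists_length_eq[of "UNIV :: bool set" n]]) auto

lemma sum_words_Suc:
  fixes g :: "bool list \<Rightarrow> 'a::comm_monoid_add"
  shows "(\<Sum>ws | length ws = Suc n. g ws)
       = (\<Sum>ws | length ws = n. g (True # ws)) + (\<Sum>ws | length ws = n. g (False # ws))"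
proof -
  have *: "{ws. length ws = Suc n} = (#) True ` {ws. length ws = n} \<union> (#) False ` {ws. length ws = n}"
    by (auto simp: length_Suc_conv)
  show ?thesis unfolding *
    by (subst sum.union_disjoint) (auto simp: sum.reindex finite_words[where P = "\<lambda>_. True", simplified])
qed

lemma coeff_word_gf:
  "coeff (word_gf f n e) k = int (card {ws. length ws = n \<and> int (f ws) \<le> e \<and> count_list ws True = k})"
proof -
  have "coeff (word_gf f n e) k
      = (\<Sum>ws | length ws = n. if int (f ws) \<le> e \<and> count_list ws True = k then 1 else 0)"
    unfolding word_gf_def coeff_sum
    by (intro sum.cong) (auto simp: X_power)
  also have "\<dots> = int (card {ws. length ws = n \<and> int (f ws) \<le> e \<and> count_list ws True = k})"
    using finite_words[where P = "\<lambda>_. True", simplified, of n]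
    by (simp add: sum.If_cases Collect_conj_eq Int_assoc)
  finally show ?thesis .
qed

lemma inner_gf_rec:
  "word_gf inner_degree (Suc (Suc n)) e
     = word_gf inner_degree (Suc n) e + X * (1 + X) * word_gf inner_degree n (e - 2)"
proof -
  have *: "2 + int m \<le> e \<longleftrightarrow> int m \<le> e - 2" for m by linarith
  have "word_gf inner_degree (Suc (Suc n)) e
      = word_gf inner_degree (Suc n) e +
        (X ^ 2 * word_gf inner_degree n (e - 2) + X * word_gf inner_degree n (e - 2))"
    unfolding word_gf_def sum_words_Suc[of _ "Suc n"] sum_words_Suc[of _ n]
    by (simp add: sum_distrib_left if_distrib * power2_eq_square mult.assoc cong: if_cong)
  then show ?thesis by (simp only: power2_eq_square algebra_simps mult_1_left mult_1_right)
qed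

lemma word_gf_split_first:
  "word_gf word_degree (Suc n) e = X * word_gf word_degree n (e - 1) + word_gf inner_degree n e"
proof -
  have *: "1 + int m \<le> e \<longleftrightarrow> int m < e" for m by linarith
  show ?thesis
    unfolding word_gf_def sum_words_Suc
    by (simp add: sum_distrib_left if_distrib * add.commute cong: if_cong)
qed

lemma word_gf_0 [simp]: "word_gf f 0 e = (if int (f []) \<le> e then 1 else 0)"
  by (simp add: word_gf_def)

lemma inner_gf_1: "word_gf inner_degree (Suc 0) e = (if 1 \<le> e then 1 + X else if 0 \<le> e then 1 else 0)"
  unfolding word_gf_def sum_words_Suc by simp

lemma word_gf_neg: "e < 0 \<Longrightarrow> word_gf f n e = 0"
  by (simp add: word_gf_def)

text \<open>
  Splitting off the first letter reduces the claim to the recursion of \<open>inner_degree\<close> until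
  \<open>n = 0\<close>, where \<open>e \<le> 0\<close> by assumption. For \<open>e = n + 1\<close> the two sides differ by \<open>X ^ (n + 1)\<close>,
  due to the words that consist of zeros only.
\<close>

lemma word_gf_rec:
  assumes "e \<le> int n"
  shows "word_gf word_degree (Suc (Suc n)) e
     = word_gf word_degree (Suc n) e + X * (1 + X) * word_gf word_degree n (e - 2)"
  using assms
proof (induction n arbitrary: e)
  case 0
  then show ?case
    by (cases "e = 0") (simp_all add: word_gf_split_first[of "Suc 0"] word_gf_split_first[of 0] word_gf_neg inner_gf_1)
next
  case (Suc n)
  have "word_gf word_degree (Suc (Suc n)) (e - 1)
     = word_gf word_degree (Suc n) (e - 1) + X * (1 + X) * word_gf word_degree n (e - 3)"
    using Suc.IH[of "e - 1"] Suc.prems by simp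
  then have "word_gf word_degree (Suc (Suc (Suc n))) e
      = X * (word_gf word_degree (Suc n) (e - 1) + X * (1 + X) * word_gf word_degree n (e - 3))
        + (word_gf inner_degree (Suc n) e + X * (1 + X) * word_gf inner_degree n (e - 2))"
    by (simp only: word_gf_split_first[of "Suc (Suc n)"] inner_gf_rec)
  also have "\<dots> = (X * word_gf word_degree (Suc n) (e - 1) + word_gf inner_degree (Suc n) e)
        + X * (1 + X) * (X * word_gf word_degree n (e - 3) + word_gf inner_degree n (e - 2))"
    by (simp only: algebra_simps)
  finally show ?case
    by (simp add: word_gf_split_first[of "Suc n"] word_gf_split_first[of n])
qed

lemma inner_gf_full: "int n \<le> e \<Longrightarrow> word_gf inner_degree n e = (1 + X) ^ n"
proof (induction n arbitrary: e rule: induct_nat_012)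
  case 0
  then show ?case by simp
next
  case 1
  then show ?case by (simp add: inner_gf_1)
next
  case (ge2 n)
  then show ?case by (simp add: inner_gf_rec algebra_simps)
qed

text \<open>
  All words except the one with zeros only are counted, so this is the face polynomial of the boundary of a
  simplex. Splitting off first letters gives it directly in the form of an h-vector with all entries one.
\<close>

lemma word_gf_simplex:
  "word_gf word_degree (Suc n) (int n) = (\<Sum>i\<le>n. X ^ i * (1 + X) ^ (n - i))"
proof (induction n)
  case 0
  show ?case by (simp add: word_gf_split_first word_gf_neg)
next
  case (Suc n)
  have "word_gf word_degree (Suc (Suc n)) (int (Suc n))
      = X * word_gf word_degree (Suc n) (int n) + (1 + X) ^ Suc n"
    by (simp add: word_gf_split_first[of "Suc n"] inner_gf_full)
  also have "\<dots> = (\<Sum>i\<le>Suc n. X ^ i * (1 + X) ^ (Suc n - i))"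
    unfolding Suc.IH sum.atMost_Suc_shift
    by (simp add: sum_distrib_left mult.assoc)
  finally show ?case .
qed

text \<open>
  The f-polynomial belonging to the h-vector; the factors \<open>(1 + X) ^ (d - i)\<close> are those of a shelling, in
  which each facet adds an interval of the Boolean lattice on its vertices.
\<close>

definition h_poly :: "nat \<Rightarrow> nat \<Rightarrow> int poly" where
  "h_poly m d = (\<Sum>i\<le>d. of_nat (cyclic_h m d i) * (X ^ i * (1 + X) ^ (d - i)))"

lemma h_poly_rec:
  "h_poly (Suc m) d = h_poly m d + (if 2 \<le> d then X * (1 + X) * h_poly (Suc m) (d - 2) else 0)"
proof -
  let ?g = "\<lambda>i. if 1 \<le> i \<and> i < d then cyclic_h (Suc m) (d - 2) (i - 1) else 0"
  have "h_poly (Suc m) d = h_poly m d + (\<Sum>i\<le>d. of_nat (?g i) * (X ^ i * (1 + X) ^ (d - i)))"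
    unfolding h_poly_def sum.distrib[symmetric]
    by (intro sum.cong refl, subst cyclic_h_rec) (simp add: algebra_simps)
  also have "(\<Sum>i\<le>d. of_nat (?g i) * (X ^ i * (1 + X) ^ (d - i)))
      = (if 2 \<le> d then X * (1 + X) * h_poly (Suc m) (d - 2) else 0)"
  proof (cases "2 \<le> d")
    case False
    then show ?thesis by (intro trans[OF sum.neutral]) auto
  next
    case True
    define e where "e = d - 2"
    have d: "d = Suc (Suc e)" using True by (simp add: e_def)
    have "(\<Sum>i\<le>d. of_nat (?g i) * (X ^ i * (1 + X) ^ (d - i)))
        = (\<Sum>i\<le>e. of_nat (cyclic_h (Suc m) e i) * (X ^ Suc i * (1 + X) ^ (Suc e - i)))"
      unfolding d sum.atMost_Suc_shift[of _ "Suc e"] sum.atMost_Suc[of _ e]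
      by (simp cong: sum.cong_simp)
    also have "\<dots> = X * (1 + X) * h_poly (Suc m) e"
      unfolding h_poly_def sum_distrib_left
      by (intro sum.cong refl) (simp add: Suc_diff_le mult_ac)
    finally show ?thesis using True by (simp add: e_def)
  qed
  finally show ?thesis .
qed

text \<open>
  Both sides satisfy the recursion that trades one vertex, or two vertices and two dimensions, and they
  agree for the simplex.
\<close>

lemma word_gf_eq_h_poly: "word_gf word_degree (d + 1 + m) (int d) = h_poly m d"
proof (induction m arbitrary: d)
  case 0
  have "cyclic_h 0 d i = 1" if "i \<le> d" for i using that by (simp add: cyclic_h_def)
  then show ?case by (simp add: word_gf_simplex h_poly_def)
next
  case (Suc m)
  show ?case
  proof (induction d rule: less_induct)
    case (less d)
    have "word_gf word_degree (d + 1 + Suc m) (int d)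
        = word_gf word_degree (d + 1 + m) (int d) + X * (1 + X) * word_gf word_degree (d + m) (int d - 2)"
      using word_gf_rec[of "int d" "d + m"] by simp
    also have "word_gf word_degree (d + m) (int d - 2) = (if 2 \<le> d then h_poly (Suc m) (d - 2) else 0)"
    proof (cases "2 \<le> d")
      case True
      then have "d + m = d - 2 + 1 + Suc m" "int d - 2 = int (d - 2)" by auto
      then show ?thesis using less[of "d - 2"] True by simp
    qed (simp add: word_gf_neg)
    finally show ?case using Suc.IH[of d] by (simp add: h_poly_rec[of m d])
  qed
qed

lemma coeff_h_poly:
  assumes "k \<le> d"
  shows "coeff (h_poly m d) (d - k) = int (iterated_sum (Suc k) (cyclic_h m d) (Suc d))"
proof -
  have "coeff (X ^ i * (1 + X) ^ (d - i)) (d - k) = int ((d - i) choose k)" if "i \<le> d" for i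
  proof -
    have "coeff (X ^ i * (1 + X) ^ (d - i)) (d - k)
        = (if d - k < i then 0 else coeff ([:1, 1:] ^ (d - i)) (d - k - i))"
      by (simp add: coeff_monom_mult X_power one_plus_X)
    also have "\<dots> = int ((d - i) choose k)"
    proof (cases "d - k < i")
      case True
      then show ?thesis using that by simp
    next
      case False
      then have "d - k - i = (d - i) - k" "k \<le> d - i" using assms by auto
      then show ?thesis
        using False by (simp add: coeff_linear_poly_power binomial_symmetric[of k "d - i"])
    qed
    finally show ?thesis .
  qed
  then show ?thesis
    by (simp add: h_poly_def coeff_sum iterated_sum_eq_binomial of_nat_poly del: iterated_sum.simps)
qed

section \<open>Points on the moment curve\<close>

lemma bij_betw_rank: "bij_betw (\<lambda>i::'n::{finite,linorder}. card {..i}) UNIV {1..CARD('n)}"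
proof -
  have "card {..i} < card {..j}" if "i < j" for i j :: 'n
    using that by (intro psubset_card_mono) auto
  then have inj: "inj (\<lambda>i::'n. card {..i})"
    by (intro linorder_injI) (auto simp: less_imp_neq)
  have "card {..i} \<in> {1..CARD('n)}" for i :: 'n
    by (auto simp: Suc_le_eq card_gt_0_iff intro: card_mono)
  then have "range (\<lambda>i::'n. card {..i}) \<subseteq> {1..CARD('n)}" by auto
  then have "range (\<lambda>i::'n. card {..i}) = {1..CARD('n)}"
    by (intro card_subset_eq) (simp_all add: card_image inj)
  with inj show ?thesis by (simp add: bij_betw_def)
qed

text \<open>
  Affine functionals on the moment curve are the polynomials of degree at most the dimension. The index
  type is turned into the exponents \<open>1, \<dots>, d\<close> by ranking.
\<close>

lemma poly_eq_inner_moment_curve: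
  fixes p :: "real poly"
  assumes "degree p \<le> CARD('n::{finite,linorder})"
  shows "poly p t = coeff p 0 + (\<chi> i::'n. coeff p (card {..i})) \<bullet> moment_curve t"
proof -
  have "poly p t = (\<Sum>k\<le>CARD('n). coeff p k * t ^ k)"
    unfolding poly_altdef using assms
    by (intro sum.mono_neutral_left) (auto simp: coeff_eq_0)
  also have "\<dots> = coeff p 0 + (\<Sum>k\<in>{1..CARD('n)}. coeff p k * t ^ k)"
    by (simp add: atMost_atLeast0 sum.atLeast_Suc_atMost)
  also have "(\<Sum>k\<in>{1..CARD('n)}. coeff p k * t ^ k)
      = (\<Sum>i\<in>(UNIV::'n set). coeff p (card {..i}) * t ^ card {..i})"
    by (rule sum.reindex_bij_betw[OF bij_betw_rank, symmetric])
  finally show ?thesis by (simp add: inner_vec_def moment_curve_def)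
qed

lemma inner_moment_curve_eq_poly:
  fixes a :: "real ^ 'n::{finite,linorder}"
  shows "\<exists>p. degree p \<le> CARD('n) \<and> (\<forall>t. poly p t = b - a \<bullet> moment_curve t)"
proof (intro exI conjI allI)
  let ?p = "[:b:] - (\<Sum>i\<in>UNIV. monom (a $ i) (card {..i}))"
  have "card {..i} \<le> CARD('n)" for i :: 'n by (intro card_mono) auto
  then show "degree ?p \<le> CARD('n)"
    by (intro degree_diff_le degree_sum_le) (auto intro: order.trans[OF degree_monom_le])
  show "poly ?p t = b - a \<bullet> moment_curve t" for t
    by (simp add: poly_sum poly_monom inner_vec_def moment_curve_def)
qed

lemma inj_moment_curve: "inj (moment_curve :: real \<Rightarrow> real ^ 'n::{finite,linorder})"
proof
  fix s t assume *: "(moment_curve s :: (real, 'n) vec) = moment_curve t"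
  have "degree [:0, 1::real:] \<le> CARD('n)" by (simp add: Suc_le_eq)
  from poly_eq_inner_moment_curve[OF this, of s] poly_eq_inner_moment_curve[OF this, of t] *
  show "s = t" by simp
qed

text \<open>
  An affine dependence would annihilate every polynomial of degree at most the dimension, in particular
  the one that vanishes at all points but a single one with nonzero coefficient.
\<close>

lemma affine_independent_moment_curve:
  assumes "finite S" and "card S \<le> CARD('n::{finite,linorder}) + 1"
  shows "\<not> affine_dependent ((moment_curve :: real \<Rightarrow> (real, 'n) vec) ` S)"
proof
  let ?c = "moment_curve :: real \<Rightarrow> (real, 'n) vec"
  have inj: "inj_on ?c S" using inj_moment_curve by (rule inj_on_subset) simp
  assume "affine_dependent (?c ` S)"
  then obtain U where "sum U (?c ` S) = 0" "\<exists>v\<in>?c ` S. U v \<noteq> 0"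
    "(\<Sum>v\<in>?c ` S. U v *\<^sub>R v) = 0"
    using affine_dependent_explicit_finite[of "?c ` S"] assms(1) by auto
  then obtain s where u: "(\<Sum>t\<in>S. U (?c t)) = 0" "(\<Sum>t\<in>S. U (?c t) *\<^sub>R ?c t) = 0"
    and s: "s \<in> S" "U (?c s) \<noteq> 0"
    by (auto simp: sum.reindex[OF inj])
  define q where "q = (\<Prod>t\<in>S - {s}. [:-t, 1:])"
  have "degree q = card (S - {s})"
    unfolding q_def by (subst degree_prod_eq_sum_degree) auto
  then have deg: "degree q \<le> CARD('n)"
    using assms s by (simp add: card_Diff_singleton)
  let ?a = "\<chi> i::'n. coeff q (card {..i})"
  have "(\<Sum>t\<in>S. U (?c t) * poly q t)
      = coeff q 0 * (\<Sum>t\<in>S. U (?c t)) + ?a \<bullet> (\<Sum>t\<in>S. U (?c t) *\<^sub>R ?c t)"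
    unfolding poly_eq_inner_moment_curve[OF deg]
    by (simp add: sum_distrib_left inner_sum_right sum.distrib algebra_simps)
  also have "\<dots> = 0" by (simp add: u)
  finally have "0 = (\<Sum>t\<in>S. U (?c t) * poly q t)" by simp
  also have "\<dots> = (\<Sum>t\<in>{s}. U (?c t) * poly q t)"
    using assms(1) s(1) by (intro sum.mono_neutral_right) (auto simp: q_def poly_prod)
  finally have "poly q s = 0" using s by simp
  then show False using assms(1) by (simp add: q_def poly_prod)
qed

lemma aff_dim_moment_curve:
  assumes "finite S" and "card S \<le> CARD('n::{finite,linorder}) + 1"
  shows "aff_dim (convex hull ((moment_curve :: real \<Rightarrow> (real, 'n) vec) ` S)) = int (card S) - 1"
proof -
  have "card ((moment_curve :: real \<Rightarrow> (real, 'n) vec) ` S) = card S"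
    using inj_moment_curve by (intro card_image) (rule inj_on_subset, auto)
  then show ?thesis
    using aff_dim_affine_independent[OF affine_independent_moment_curve[OF assms]]
    by (simp add: aff_dim_convex_hull)
qed

section \<open>Faces of cyclic polytopes\<close>

text \<open>
  The graph of the polynomial on \<open>T\<close> lies above the axis and touches it exactly at \<open>S\<close>: read as an affine
  functional on the moment curve, it supports the polytope exactly along the points of \<open>S\<close>. If \<open>T\<close> has more
  than \<open>d\<close> elements, the bound on the cardinality excludes the zero polynomial, that is, the polytope as a face
  of itself.
\<close>

definition face_parameters :: "nat \<Rightarrow> real set \<Rightarrow> real set \<Rightarrow> bool" where
  "face_parameters d T S \<longleftrightarrow> S \<subseteq> T \<and> card S \<le> d \<and>
     (\<exists>p. degree p \<le> d \<and> (\<forall>t\<in>S. poly p t = 0) \<and> (\<forall>t\<in>T - S. 0 < poly p t))"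

lemma face_of_cyclic_polytope_eq:
  fixes T :: "real set"
  assumes "finite T" and "F face_of (cyclic_polytope T :: (real ^ 'n::{finite,linorder}) set)"
  shows "F = convex hull (moment_curve ` {t \<in> T. moment_curve t \<in> F})"
proof
  have "compact ((moment_curve :: real \<Rightarrow> (real, 'n) vec) ` T)"
    using assms(1) by (simp add: finite_imp_compact)
  then obtain V where V: "V \<subseteq> moment_curve ` T" "F = convex hull V"
    using assms(2) unfolding cyclic_polytope_def by (rule face_of_convex_hull_subset)
  have "V \<subseteq> moment_curve ` {t \<in> T. moment_curve t \<in> F}"
    using V hull_subset[of V convex] by auto
  then show "F \<subseteq> convex hull (moment_curve ` {t \<in> T. moment_curve t \<in> F})"
    unfolding V(2)[symmetric] by (subst V(2)) (rule hull_mono)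
  show "convex hull (moment_curve ` {t \<in> T. moment_curve t \<in> F}) \<subseteq> F"
    using face_of_imp_convex[OF assms(2)] by (intro hull_minimal) (auto simp: cyclic_polytope_def)
qed

lemma face_of_cyclic_polytope:
  fixes T :: "real set"
  assumes T: "finite T" and S: "face_parameters CARD('n::{finite,linorder}) T S"
  defines "F \<equiv> convex hull ((moment_curve :: real \<Rightarrow> (real, 'n) vec) ` S)"
  shows "F face_of cyclic_polytope T" and "{t \<in> T. moment_curve t \<in> F} = S"
proof -
  let ?c = "moment_curve :: real \<Rightarrow> (real, 'n) vec"
  let ?P = "cyclic_polytope T :: (real, 'n) vec set"
  obtain p where p: "degree p \<le> CARD('n)" "\<And>t. t \<in> S \<Longrightarrow> poly p t = 0"
    "\<And>t. t \<in> T \<Longrightarrow> t \<notin> S \<Longrightarrow> 0 < poly p t" and ST: "S \<subseteq> T"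
    using S by (auto simp: face_parameters_def)
  define a where "a = (\<chi> i::'n. - coeff p (card {..i}))"
  define b where "b = coeff p 0"
  have pab: "poly p t = b - a \<bullet> ?c t" for t
    unfolding poly_eq_inner_moment_curve[OF p(1)] by (simp add: a_def b_def inner_vec_def sum_negf)
  have "?P \<subseteq> {x. a \<bullet> x \<le> b}"
    unfolding cyclic_polytope_def
  proof (intro hull_minimal convex_halfspace_le)
    show "?c ` T \<subseteq> {x. a \<bullet> x \<le> b}" using p(2,3) pab by (force simp: less_imp_le)
  qed
  then have face: "?P \<inter> {x. a \<bullet> x = b} face_of ?P"
    by (intro face_of_Int_supporting_hyperplane_le) (auto simp: cyclic_polytope_def)
  have "?c t \<in> ?P" if "t \<in> T" for t
    using that by (simp add: cyclic_polytope_def hull_inc)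
  then have *: "{t \<in> T. ?c t \<in> ?P \<inter> {x. a \<bullet> x = b}} = S"
    using ST p(2,3) pab by (force simp: order.strict_iff_order)
  have "?P \<inter> {x. a \<bullet> x = b} = F"
    using face_of_cyclic_polytope_eq[OF T face] unfolding * F_def .
  then show "F face_of ?P" and "{t \<in> T. ?c t \<in> F} = S" using face * by auto
qed

text \<open>
  Faces of a polytope are exposed, and a hyperplane cutting out a proper face restricts to a nonzero
  polynomial on the curve; its number of roots bounds the number of points on the face.
\<close>

lemma face_parameters_of_face:
  fixes T :: "real set" and F :: "(real ^ 'n::{finite,linorder}) set"
  assumes T: "finite T" and F: "F face_of cyclic_polytope T" and ne: "F \<noteq> cyclic_polytope T"
  shows "face_parameters CARD('n) T {t \<in> T. moment_curve t \<in> F}"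
proof -
  let ?c = "moment_curve :: real \<Rightarrow> (real, 'n) vec"
  let ?P = "cyclic_polytope T :: (real, 'n) vec set"
  let ?S = "{t \<in> T. ?c t \<in> F}"
  have "polyhedron ?P"
    unfolding cyclic_polytope_def using T by (intro polyhedron_convex_hull) auto
  then have "F exposed_face_of ?P" using F by (simp add: exposed_face_of_polyhedron)
  then obtain a b where ab: "?P \<subseteq> {x. a \<bullet> x \<le> b}" "F = ?P \<inter> {x. a \<bullet> x = b}"
    by (auto simp: exposed_face_of_def)
  obtain p where p: "degree p \<le> CARD('n)" "\<And>t. poly p t = b - a \<bullet> ?c t"
    using inner_moment_curve_eq_poly[where a = a and b = b] by auto
  have inP: "?c t \<in> ?P" if "t \<in> T" for t
    using that by (simp add: cyclic_polytope_def hull_inc)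
  have S: "?S = {t \<in> T. poly p t = 0}" using inP by (auto simp: ab(2) p(2))
  have pos: "0 \<le> poly p t" if "t \<in> T" for t
    using inP[OF that] ab(1) by (auto simp: p(2))
  have "?S \<noteq> T"
  proof
    assume "?S = T"
    then show False
      using face_of_cyclic_polytope_eq[OF T F] ne by (simp add: cyclic_polytope_def)
  qed
  then have "p \<noteq> 0" unfolding S by (rule contrapos_nn) simp
  then have "card {t. poly p t = 0} \<le> degree p" "finite {t. poly p t = 0}"
    by (simp_all add: card_poly_roots_bound poly_roots_finite)
  moreover from this have "card ?S \<le> card {t. poly p t = 0}"
    unfolding S by (intro card_mono) auto
  ultimately have "card ?S \<le> CARD('n)" using p(1) by linarith
  moreover have "0 < poly p t" if t: "t \<in> T - ?S" for t
  proof -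
    have "t \<in> T" using t by (rule DiffD1)
    moreover have "t \<notin> {t \<in> T. poly p t = 0}" using t unfolding S Diff_iff by (rule conjunct2)
    ultimately have "poly p t \<noteq> 0" by blast
    then show ?thesis using pos[OF \<open>t \<in> T\<close>] by linarith
  qed
  moreover have "poly p t = 0" if t: "t \<in> ?S" for t
    using t unfolding S mem_Collect_eq by (rule conjunct2)
  ultimately show ?thesis
    unfolding face_parameters_def using p(1) by (intro conjI exI[of _ p] ballI) blast+
qed

lemma aff_dim_cyclic_polytope:
  assumes "finite T" and "CARD('n::{finite,linorder}) < card T"
  shows "aff_dim (cyclic_polytope T :: (real, 'n) vec set) = int CARD('n)"
proof -
  obtain S where S: "S \<subseteq> T" "card S = CARD('n) + 1"
    using assms obtain_subset_with_card_n[of "CARD('n) + 1" T] by auto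
  have "finite S" using S assms(1) finite_subset by blast
  then have "int CARD('n) = aff_dim (convex hull ((moment_curve :: real \<Rightarrow> (real, 'n) vec) ` S))"
    using S by (simp add: aff_dim_moment_curve)
  also have "\<dots> \<le> aff_dim (cyclic_polytope T :: (real, 'n) vec set)"
    unfolding cyclic_polytope_def using S by (intro aff_dim_subset hull_mono) auto
  finally show ?thesis
    using aff_dim_le_DIM[of "cyclic_polytope T :: (real, 'n) vec set"] by simp
qed

lemma num_faces_top:
  assumes "finite T" and "CARD('n::{finite,linorder}) < card T"
  shows "num_faces (cyclic_polytope T :: (real, 'n) vec set) (int CARD('n)) = 1"
proof -
  let ?P = "cyclic_polytope T :: (real, 'n) vec set"
  have P: "convex ?P" by (simp add: cyclic_polytope_def)
  have "{F. F face_of ?P \<and> aff_dim F = int CARD('n)} = {?P}"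
    using face_of_aff_dim_lt[OF P] aff_dim_cyclic_polytope[OF assms] face_of_refl[OF P] by force
  then show ?thesis by (simp add: num_faces_def)
qed

text \<open>
  Proper faces are simplices, since at most \<open>d\<close> points of the curve lie on them. Hence the dimension
  determines the number of vertices.
\<close>

lemma num_faces_eq_card_face_parameters:
  assumes "finite T" and "CARD('n::{finite,linorder}) < card T" and "k \<le> CARD('n)"
  shows "num_faces (cyclic_polytope T :: (real, 'n) vec set) (int k - 1)
       = card {S. face_parameters CARD('n) T S \<and> card S = k}"
proof -
  let ?c = "moment_curve :: real \<Rightarrow> (real, 'n) vec"
  let ?P = "cyclic_polytope T :: (real, 'n) vec set"
  have dim: "aff_dim (convex hull (?c ` S)) = int (card S) - 1"
    if "face_parameters CARD('n) T S" for S
    using that assms(1) by (intro aff_dim_moment_curve) (auto simp: face_parameters_def intro: finite_subset)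
  have "bij_betw (\<lambda>S. convex hull (?c ` S)) {S. face_parameters CARD('n) T S \<and> card S = k}
     {F. F face_of ?P \<and> aff_dim F = int k - 1}"
  proof (rule bij_betw_byWitness[where f' = "\<lambda>F. {t \<in> T. ?c t \<in> F}"])
    show "\<forall>S\<in>{S. face_parameters CARD('n) T S \<and> card S = k}. {t \<in> T. ?c t \<in> convex hull (?c ` S)} = S"
      using face_of_cyclic_polytope(2)[OF assms(1)] by blast
    show "\<forall>F\<in>{F. F face_of ?P \<and> aff_dim F = int k - 1}. convex hull (?c ` {t \<in> T. ?c t \<in> F}) = F"
      using face_of_cyclic_polytope_eq[OF assms(1)] by blast
    show "(\<lambda>S. convex hull (?c ` S)) ` {S. face_parameters CARD('n) T S \<and> card S = k}
        \<subseteq> {F. F face_of ?P \<and> aff_dim F = int k - 1}"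
      using face_of_cyclic_polytope(1)[OF assms(1)] dim by auto
    show "(\<lambda>F. {t \<in> T. ?c t \<in> F}) ` {F. F face_of ?P \<and> aff_dim F = int k - 1}
        \<subseteq> {S. face_parameters CARD('n) T S \<and> card S = k}"
    proof safe
      fix F assume F: "F face_of ?P" "aff_dim F = int k - 1"
      have "F \<noteq> ?P" using F(2) aff_dim_cyclic_polytope[OF assms(1,2)] assms(3) by auto
      then show *: "face_parameters CARD('n) T {t \<in> T. ?c t \<in> F}"
        using face_parameters_of_face[OF assms(1) F(1)] by blast
      show "card {t \<in> T. ?c t \<in> F} = k"
        using dim[OF *] F(2) face_of_cyclic_polytope_eq[OF assms(1) F(1)] by simp
    qed
  qed
  then show ?thesis unfolding num_faces_def by (rule bij_betw_same_card[symmetric])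
qed

section \<open>Faces and words\<close>

lemma realises_map:
  "realises p ts (map (\<lambda>t. t \<in> S) ts) \<longleftrightarrow>
     (\<forall>t\<in>set ts \<inter> S. poly p t = 0) \<and> (\<forall>t\<in>set ts - S. 0 < poly p t)"
  unfolding realises_def list.rel_map list_all2_same by safe simp_all

lemma bij_betw_subsets_words:
  assumes "distinct ts"
  shows "bij_betw (\<lambda>S. map (\<lambda>t. t \<in> S) ts) (Pow (set ts)) {ws. length ws = length ts}"
  unfolding bij_betw_def
proof
  show inj: "inj_on (\<lambda>S. map (\<lambda>t. t \<in> S) ts) (Pow (set ts))"
    by (intro inj_onI) auto
  have fin: "finite {ws :: bool list. length ws = length ts}"
    using finite_words[where P = "\<lambda>_. True"] by simp
  have "card {ws :: bool list. length ws = length ts} = 2 ^ length ts"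
    using card_lists_length_eq[of "UNIV :: bool set" "length ts"] by simp
  also have "\<dots> = card ((\<lambda>S. map (\<lambda>t. t \<in> S) ts) ` Pow (set ts))"
    using assms by (simp add: card_image[OF inj] card_Pow distinct_card)
  finally show "(\<lambda>S. map (\<lambda>t. t \<in> S) ts) ` Pow (set ts) = {ws. length ws = length ts}"
    using fin by (intro card_subset_eq) auto
qed

lemma face_parameters_iff_word_degree:
  assumes "finite T" and "S \<subseteq> T" and "card S = k" and "k \<le> d" and "d < card T"
  shows "face_parameters d T S \<longleftrightarrow> word_degree (map (\<lambda>t. t \<in> S) (sorted_list_of_set T)) \<le> d"
proof -
  let ?ts = "sorted_list_of_set T"
  let ?ws = "map (\<lambda>t. t \<in> S) ?ts"
  have T: "set ?ts = T" "sorted_wrt (<) ?ts" using assms(1) by auto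
  have "T - S \<noteq> {}"
  proof
    assume "T - S = {}"
    then have "S = T" using assms(2) by auto
    then show False using assms by simp
  qed
  have "face_parameters d T S \<longleftrightarrow> (\<exists>p. degree p \<le> d \<and> realises p ?ts ?ws)"
    using assms(2-4) by (auto simp: face_parameters_def realises_map T(1) Int_absorb1)
  also have "\<dots> \<longleftrightarrow> word_degree ?ws \<le> d"
  proof
    assume "\<exists>p. degree p \<le> d \<and> realises p ?ts ?ws"
    then obtain p where p: "degree p \<le> d" "realises p ?ts ?ws" by blast
    have "p \<noteq> 0" using p(2) \<open>T - S \<noteq> {}\<close> by (auto simp: realises_map T(1))
    then show "word_degree ?ws \<le> d" using word_degree_le_degree[OF T(2) p(2)] p(1) by simp
  next
    assume "word_degree ?ws \<le> d"
    then show "\<exists>p. degree p \<le> d \<and> realises p ?ts ?ws"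
      using ex_realises[OF T(2), of ?ws] by (auto intro: order.trans)
  qed
  finally show ?thesis .
qed

lemma card_face_parameters:
  assumes "finite T" and "d < card T" and "k \<le> d"
  shows "int (card {S. face_parameters d T S \<and> card S = k}) = coeff (h_poly (card T - d - 1) d) k"
proof -
  let ?ts = "sorted_list_of_set T"
  let ?w = "\<lambda>S. map (\<lambda>t. t \<in> S) ?ts"
  have T: "set ?ts = T" "distinct ?ts" "length ?ts = card T" using assms(1) by auto
  have cnt: "count_list (?w S) True = card S" if "S \<subseteq> T" for S
  proof -
    have "count_list (?w S) True = length (filter (\<lambda>t. t \<in> S) ?ts)"
      by (simp add: count_list_eq_length_filter filter_map comp_def)
    also have "\<dots> = card (set (filter (\<lambda>t. t \<in> S) ?ts))"
      using T(2) by (simp add: distinct_card del: set_filter)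
    also have "set (filter (\<lambda>t. t \<in> S) ?ts) = S" using that T(1) by auto
    finally show ?thesis .
  qed
  have bij: "bij_betw ?w (Pow T) {ws. length ws = card T}"
    using bij_betw_subsets_words[OF T(2)] by (simp only: T)
  have *: "{S. face_parameters d T S \<and> card S = k}
      = {S \<in> Pow T. word_degree (?w S) \<le> d \<and> count_list (?w S) True = k}"
    using face_parameters_iff_word_degree[OF assms(1) _ _ assms(3,2)] cnt assms(3)
    by (auto simp: face_parameters_def)
  have "bij_betw ?w {S. face_parameters d T S \<and> card S = k}
      {ws \<in> {ws. length ws = card T}. word_degree ws \<le> d \<and> count_list ws True = k}"
    unfolding * using bij by (rule bij_betw_Collect) auto
  then have "card {S. face_parameters d T S \<and> card S = k}
      = card {ws. length ws = card T \<and> int (word_degree ws) \<le> int d \<and> count_list ws True = k}"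
    using bij_betw_same_card by fastforce
  also have "int \<dots> = coeff (word_gf word_degree (card T) (int d)) k"
    by (rule coeff_word_gf[symmetric])
  also have "card T = d + 1 + (card T - d - 1)" using assms(2) by simp
  finally show ?thesis by (simp only: word_gf_eq_h_poly)
qed

text \<open>
  Faces are counted by codimension \<open>k + 1\<close>; their number is the \<open>(k + 1)\<close>-st iterated sum of the h-vector.
\<close>

lemma num_faces_cyclic_polytope:
  assumes "finite T" and "CARD('n::{finite,linorder}) < card T" and "k \<le> CARD('n)"
  shows "num_faces (cyclic_polytope T :: (real, 'n) vec set) (int (CARD('n) - k) - 1)
       = iterated_sum (Suc k) (cyclic_h (card T - CARD('n) - 1) CARD('n)) (Suc CARD('n))"
proof -
  let ?d = "CARD('n)"
  have "int (num_faces (cyclic_polytope T :: (real, 'n) vec set) (int (?d - k) - 1))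
      = coeff (h_poly (card T - ?d - 1) ?d) (?d - k)"
    using num_faces_eq_card_face_parameters[OF assms(1,2), of "?d - k"]
      card_face_parameters[OF assms(1,2), of "?d - k"] by simp
  also have "\<dots> = int (iterated_sum (Suc k) (cyclic_h (card T - ?d - 1) ?d) (Suc ?d))"
    by (rule coeff_h_poly[OF assms(3)])
  finally show ?thesis by (simp only: of_nat_eq_iff)
qed

section \<open>Log-concavity of the f-vector\<close>

text \<open>
  The remaining case, with \<open>f d = 1\<close> as last term. The h-vector has \<open>d + 1\<close> positive entries, so there are
  more than \<open>d\<close> facets, and each facet has only \<open>d\<close> ridges.
\<close>

lemma ridges_le_facets_squared:
  "iterated_sum 2 (cyclic_h m d) (Suc d) \<le> (iterated_sum 1 (cyclic_h m d) (Suc d))\<^sup>2"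
proof -
  let ?h = "cyclic_h m d"
  define f where "f = (\<Sum>i\<le>d. ?h i)"
  have "(\<Sum>i\<le>d. 1) \<le> f"
    unfolding f_def by (intro sum_mono) (simp add: Suc_le_eq cyclic_h_pos)
  then have "d \<le> f" by simp
  have "iterated_sum 2 ?h (Suc d) = (\<Sum>i\<le>d. ?h i * (d - i))"
    using iterated_sum_eq_binomial[of 1 ?h d] by (simp add: numeral_2_eq_2 del: iterated_sum.simps)
  also have "\<dots> \<le> (\<Sum>i\<le>d. ?h i * f)"
    using \<open>d \<le> f\<close> by (intro sum_mono mult_left_mono) auto
  also have "\<dots> = f\<^sup>2" by (simp add: f_def power2_eq_square sum_distrib_right)
  also have "f = iterated_sum 1 ?h (Suc d)"
    using iterated_sum_eq_binomial[of 0 ?h d] by (simp add: f_def del: iterated_sum.simps)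
  finally show ?thesis .
qed

theorem mainTheorem1:
  fixes v d :: nat and T :: "real set"
  assumes "d = CARD('n::{finite,linorder})" and "d \<ge> 1" and "v \<ge> d + 1"
    and "finite T" and "card T = v"
  shows "log_concave (num_faces (cyclic_polytope T :: (real ^ 'n::{finite,linorder}) set)) (int d)"
  unfolding log_concave_def
proof (intro allI impI)
  fix i :: int assume i: "-1 < i \<and> i < int d"
  let ?f = "num_faces (cyclic_polytope T :: (real, 'n) vec set)"
  let ?h = "cyclic_h (card T - d - 1) d"
  have f: "?f (int (d - k) - 1) = iterated_sum (Suc k) ?h (Suc d)" if "k \<le> d" for k
    using num_faces_cyclic_polytope[where 'n = 'n, of T k] assms that by simp
  \<comment> \<open>\<open>k + 1\<close> is the codimension of the middle term.\<close>
  define k where "k = nat (int d - 1 - i)"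
  have k: "i = int (d - k) - 1" "Suc k \<le> d" using i by (auto simp: k_def)
  have lower: "?f (i - 1) = iterated_sum (Suc (Suc k)) ?h (Suc d)"
    using f[OF k(2)] k by (simp add: of_nat_diff del: iterated_sum.simps)
  have mid: "?f i = iterated_sum (Suc k) ?h (Suc d)"
    using f[of k] k by simp
  show "?f (i - 1) * ?f (i + 1) \<le> (?f i)\<^sup>2"
  proof (cases k)
    case 0
    then have "?f (i + 1) = 1"
      using num_faces_top[where 'n = 'n, of T] assms k(1) by simp
    then show ?thesis
      unfolding lower mid using ridges_le_facets_squared[of "card T - d - 1" d] 0
      by (simp add: numeral_2_eq_2 del: iterated_sum.simps)
  next
    case (Suc j)
    then have "?f (i + 1) = iterated_sum k ?h (Suc d)"
      using f[of j] k by (simp add: of_nat_diff del: iterated_sum.simps)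
    then show ?thesis
      unfolding lower mid
      using iterated_sum_log_concave[OF log_concave_cyclic_h] by (simp only: mult.commute)
  qed
qed

end
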